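(* Let $r\in(0,1)$ and $k>0$. Let $$H(1,k)=\left\{\alpha\in\mathbb{D}:\tfrac{|\alpha-1|^2}{1-|\alpha|^2}=k\right\}\cup\{1\},$$ and let $\mathscr{D}_1=\{z\in\mathbb{C}:|z-c_1|<R_1\}$ and $\mathscr{D}_2=\{z\in\mathbb{C}:|z-c_2|<R_2\}$, where $$c_1=\tfrac{1-r}{(1-r)+k(1+r)},\quad R_1=1-c_1=\tfrac{k(1+r)}{(1-r)+k(1+r)},\quad c_2=\tfrac{1+r}{(1+r)+k(1-r)},\quad R_2=1-c_2=\tfrac{k(1-r)}{(1+r)+k(1-r)}.$$ Then the union $\bigcup_{\alpha\in H(1,k)}D_\rho(\alpha,r)$ of pseudohyperbolic disks has boundary $\partial\mathscr{D}_1\cup\partial\mathscr{D}_2$.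
   Context: $\mathbb{D}$ is the open unit disk in $\mathbb{C}$. For $\beta\in\mathbb{D}$ and $r\in(0,1)$, the pseudohyperbolic disk is $D_\rho(\beta,r)=\left\{z\in\mathbb{C}:\left|\frac{z-\beta}{1-\bar\beta z}\right|<r\right\}$; it is the open Euclidean disk with center $\frac{(1-r^2)\beta}{1-r^2|\beta|^2}$ and radius $\frac{r(1-|\beta|^2)}{1-r^2|\beta|^2}$. For $\beta=1$ the same Euclidean formulas are used, giving center $1$ and radius $0$, so $D_\rho(1,r)$ is the empty set. The set $H(1,k)$ (a horocycle) is the circle with center $\frac{1}{k+1}$ and radius $\frac{k}{k+1}$. Boundary means topological boundary in $\mathbb{C}$. *)

theory Defs
  imports "HOL-Analysis.Analysis"
begin

text \<open>
  In the first case the condition \<^term>\<open>1 - cnj \<beta> * z \<noteq> 0\<close> is needed because division by zero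
  yields zero: without it the pole \<^term>\<open>1 / cnj \<beta>\<close>, which lies outside the unit disk, would
  belong to the set.  Off the open unit disk (used only for \<open>\<beta> = 1\<close>) the Euclidean description
  of pseudohyperbolic disks is taken as the definition; for \<open>\<beta> = 1\<close> it gives the ball of
  centre \<open>1\<close> and radius \<open>0\<close>, which is empty.
\<close>

definition pseudohyp_disk :: "complex \<Rightarrow> real \<Rightarrow> complex set" where
  "pseudohyp_disk \<beta> r =
    (if \<beta> \<in> ball 0 1
     then {z. 1 - cnj \<beta> * z \<noteq> 0 \<and> cmod ((z - \<beta>) / (1 - cnj \<beta> * z)) < r}
     else ball (of_real ((1 - r\<^sup>2) / (1 - r\<^sup>2 * (cmod \<beta>)\<^sup>2)) * \<beta>)
               (r * (1 - (cmod \<beta>)\<^sup>2) / (1 - r\<^sup>2 * (cmod \<beta>)\<^sup>2)))"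

definition horocycle :: "complex \<Rightarrow> real \<Rightarrow> complex set" where
  "horocycle \<zeta> k =
    {\<alpha> \<in> ball 0 1. (cmod (\<alpha> - \<zeta>))\<^sup>2 / (1 - (cmod \<alpha>)\<^sup>2) = k} \<union> {\<zeta>}"

end

theory Submission
  imports Defs
begin

text \<open>
  The Cayley transform \<open>z \<mapsto> (1 + z) / (1 - z)\<close> maps the unit disk onto the right half-plane and the
  horocycle onto the vertical line \<open>Re w = 1 / k\<close>. The pseudohyperbolic disks centred on that line
  are vertical translates of one another, so they sweep out the strip
  \<open>(1 - r) / (k * (1 + r)) < Re w < (1 + r) / (k * (1 - r))\<close>. Back in the unit disk the strip is the
  open disk \<open>\<D>\<^sub>1\<close> minus the closure of \<open>\<D>\<^sub>2\<close>. The two circles are internally tangent at \<open>1\<close>, and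
  the tangency point is a limit of other points of the outer circle, so both circles lie in the
  boundary.
\<close>

section \<open>Frontier of a disk with an internally tangent disk removed\<close>

text \<open>Off \<open>p\<close>, the outer sphere lies in the open complement of the inner ball and
  the inner sphere lies in the open outer ball, so both are approached from within the difference.
  The point \<open>p\<close> is reached as a limit along the outer sphere; in dimension 1 that
  sphere is just two points, hence the dimension bound.\<close>

lemma frontier_ball_diff_tangent_cball:
  fixes c d p :: "'a::euclidean_space"
  assumes dim: "2 \<le> DIM('a)" and R: "0 < R" and S: "0 < S" and p: "dist c p = R"
    and sub: "cball d S - {p} \<subseteq> ball c R"
  shows "frontier (ball c R - cball d S) = sphere c R \<union> sphere d S"
proof -
  let ?U = "ball c R - cball d S"
  have opn: "open ?U" by (simp add: open_Diff)
  have cl1: "closure ?U \<subseteq> cball c R - ball d S"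
    by (rule closure_minimal) (auto intro: closed_Diff)
  have s1: "sphere c R - {p} \<subseteq> closure ?U"
  proof -
    have "sphere c R - {p} \<subseteq> (- cball d S) \<inter> closure (ball c R)"
      using sub R by auto
    also have "\<dots> \<subseteq> closure (- cball d S \<inter> ball c R)"
      by (rule open_Int_closure_subset) auto
    finally show ?thesis by (simp add: Diff_eq Int_commute)
  qed
  \<comment> \<open>A connected set with at least two points has no isolated point; the second point
    is the antipode \<open>2 *\<^sub>R c - p\<close>.\<close>
  have "p islimpt sphere c R"
  proof (rule connected_imp_perfect)
    show "connected (sphere c R)" using dim by (rule connected_sphere)
    show "p \<in> sphere c R" using p by simp
    show "sphere c R \<noteq> {a}" for a
    proof
      assume a: "sphere c R = {a}"
      have "p \<in> sphere c R" "2 *\<^sub>R c - p \<in> sphere c R"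
        using p by (auto simp: dist_norm norm_minus_commute scaleR_2)
      then have "2 *\<^sub>R c = 2 *\<^sub>R p" using a by (auto simp: scaleR_2 algebra_simps)
      then show False using p R by simp
    qed
  qed
  then have "p islimpt (sphere c R - {p})" using islimpt_punctured by blast
  then have "p islimpt closure ?U"
    using s1 by (rule islimpt_subset)
  then have pU: "p \<in> closure ?U"
    using closed_limpt[of "closure ?U"] by blast
  have s2: "sphere d S - {p} \<subseteq> closure ?U"
  proof -
    have "sphere d S - {p} \<subseteq> ball c R \<inter> closure (- cball d S)"
      using sub S by (auto simp: closure_complement)
    also have "\<dots> \<subseteq> closure (ball c R \<inter> - cball d S)"
      by (rule open_Int_closure_subset) auto
    finally show ?thesis by (simp add: Diff_eq)
  qed
  have "frontier ?U = closure ?U - ?U"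
    using opn by (simp add: frontier_def interior_open)
  also have "\<dots> = sphere c R \<union> sphere d S"
  proof
    show "closure ?U - ?U \<subseteq> sphere c R \<union> sphere d S" using cl1 by auto
    have "sphere c R \<union> sphere d S \<subseteq> closure ?U" using s1 s2 pU by blast
    then show "sphere c R \<union> sphere d S \<subseteq> closure ?U - ?U" by auto
  qed
  finally show ?thesis .
qed

section \<open>Circles through 1 with real centre\<close>

text \<open>The left side is the power of \<open>z\<close> with respect to the circle through 1
  centred at \<open>c\<close>. These circles form the tangent pencil spanned by the unit circle
  (\<open>c = 0\<close>) and the point circle at 1 (\<open>c = 1\<close>), hence the linear
  combination.\<close>

lemma dist_horocycle_centre:
  fixes z :: complex and c :: real
  shows "(dist (of_real c) z)\<^sup>2 - (1 - c)\<^sup>2 = c * (cmod (1 - z))\<^sup>2 - (1 - c) * (1 - (cmod z)\<^sup>2)"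
  unfolding dist_norm cmod_power2 by (simp add: power2_eq_square algebra_simps)

text \<open>Both parts read off the sign of the power of \<open>z\<close>. For
  \<open>z \<noteq> 1\<close> this compares \<open>c / (1 - c)\<close> with the real part of the
  Cayley image; the product form also covers \<open>z = 1\<close>.\<close>

lemma horoball_iff:
  fixes z :: complex
  assumes "c < 1"
  shows "z \<in> ball (of_real c) (1 - c) \<longleftrightarrow> c * (cmod (1 - z))\<^sup>2 < (1 - c) * (1 - (cmod z)\<^sup>2)"
    and "z \<in> cball (of_real c) (1 - c) \<longleftrightarrow> c * (cmod (1 - z))\<^sup>2 \<le> (1 - c) * (1 - (cmod z)\<^sup>2)"
proof -
  have "dist (of_real c) z < 1 - c \<longleftrightarrow> (dist (of_real c) z)\<^sup>2 < (1 - c)\<^sup>2"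
    using assms power_mono_iff[of "1 - c" "dist (of_real c) z" 2] by (simp add: not_le[symmetric])
  then show "z \<in> ball (of_real c) (1 - c) \<longleftrightarrow> c * (cmod (1 - z))\<^sup>2 < (1 - c) * (1 - (cmod z)\<^sup>2)"
    using dist_horocycle_centre[of c z] unfolding mem_ball by linarith
  have "dist (of_real c) z \<le> 1 - c \<longleftrightarrow> (dist (of_real c) z)\<^sup>2 \<le> (1 - c)\<^sup>2"
    using assms by (simp add: power_mono_iff)
  then show "z \<in> cball (of_real c) (1 - c) \<longleftrightarrow> c * (cmod (1 - z))\<^sup>2 \<le> (1 - c) * (1 - (cmod z)\<^sup>2)"
    using dist_horocycle_centre[of c z] unfolding mem_cball by linarith
qed

section \<open>The Cayley transform and pseudohyperbolic disks\<close>

definition cayley :: "complex \<Rightarrow> complex" where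
  "cayley z = (1 + z) / (1 - z)"

text \<open>At \<open>z = 1\<close> both sides are 0, since division by zero yields zero.\<close>

lemma Re_cayley: "Re (cayley z) = (1 - (cmod z)\<^sup>2) / (cmod (1 - z))\<^sup>2"
  unfolding cayley_def Re_divide cmod_power2
  by (simp add: power2_eq_square algebra_simps diff_divide_distrib add_divide_distrib)

text \<open>The preimage \<open>(w - 1) / (w + 1)\<close> lies in the disk because points of the
  right half-plane are nearer to 1 than to -1.\<close>

lemma cayley_surj:
  assumes "0 < Re w"
  obtains z where "cmod z < 1" "cayley z = w"
proof
  have nz: "w + 1 \<noteq> 0" using assms by (auto simp: complex_eq_iff)
  have "(cmod (w - 1))\<^sup>2 < (cmod (w + 1))\<^sup>2"
    using assms unfolding cmod_power2 by (simp add: power2_eq_square algebra_simps)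
  then have "cmod (w - 1) < cmod (w + 1)" by (rule power2_less_imp_less) simp
  then show "cmod ((w - 1) / (w + 1)) < 1" using nz by (simp add: norm_divide)
  have "1 + (w - 1) / (w + 1) = 2 * w / (w + 1)" "1 - (w - 1) / (w + 1) = 2 / (w + 1)"
    using nz by (simp_all add: field_simps)
  then show "cayley ((w - 1) / (w + 1)) = w"
    using nz by (simp add: cayley_def)
qed

text \<open>Numerator and denominator of the pseudohyperbolic distance acquire the same factor,
  which cancels in the quotient and leaves the half-plane distance.\<close>

lemma pseudohyp_cayley:
  assumes "z \<noteq> 1" "\<alpha> \<noteq> 1"
  shows "cmod (z - \<alpha>) = cmod (1 - z) * cmod (1 - \<alpha>) / 2 * cmod (cayley z - cayley \<alpha>)"
    and "cmod (1 - cnj \<alpha> * z) = cmod (1 - z) * cmod (1 - \<alpha>) / 2 * cmod (cayley z + cnj (cayley \<alpha>))"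
proof -
  have nz: "1 - z \<noteq> 0" "1 - \<alpha> \<noteq> 0" "1 - cnj \<alpha> \<noteq> 0"
    using assms complex_cnj_cancel_iff[of \<alpha> 1] by auto
  have cayley: "(1 - z) * cayley z = 1 + z" "(1 - \<alpha>) * cayley \<alpha> = 1 + \<alpha>"
    "(1 - cnj \<alpha>) * cnj (cayley \<alpha>) = 1 + cnj \<alpha>"
    using nz by (simp_all add: cayley_def)
  have "2 * (z - \<alpha>) = (1 - z) * (1 - \<alpha>) * (cayley z - cayley \<alpha>)"
    using cayley(1,2) by algebra
  then have "z - \<alpha> = (1 - z) * (1 - \<alpha>) / 2 * (cayley z - cayley \<alpha>)"
    by (simp add: mult.commute)
  then show "cmod (z - \<alpha>) = cmod (1 - z) * cmod (1 - \<alpha>) / 2 * cmod (cayley z - cayley \<alpha>)"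
    by (metis norm_mult norm_divide norm_numeral)
  have "2 * (1 - cnj \<alpha> * z) = (1 - z) * (1 - cnj \<alpha>) * (cayley z + cnj (cayley \<alpha>))"
    using cayley(1,3) by algebra
  then have "1 - cnj \<alpha> * z = (1 - z) * (1 - cnj \<alpha>) / 2 * (cayley z + cnj (cayley \<alpha>))"
    by (simp add: mult.commute)
  moreover have "cmod (1 - cnj \<alpha>) = cmod (1 - \<alpha>)"
    by (metis complex_cnj_diff complex_cnj_one complex_mod_cnj)
  ultimately show "cmod (1 - cnj \<alpha> * z) =
      cmod (1 - z) * cmod (1 - \<alpha>) / 2 * cmod (cayley z + cnj (cayley \<alpha>))"
    by (metis norm_mult norm_divide norm_numeral)
qed

lemma pseudohyp_disk_iff:
  assumes \<alpha>: "cmod \<alpha> < 1" and r: "0 < r" "r < 1"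
  shows "z \<in> pseudohyp_disk \<alpha> r \<longleftrightarrow>
    cmod z < 1 \<and> cmod (cayley z - cayley \<alpha>) < r * cmod (cayley z + cnj (cayley \<alpha>))"
proof -
  \<comment> \<open>Multiplied out, the strict inequality fails at the pole because its right side
    is 0 there, in agreement with the definition.\<close>
  have disk: "z \<in> pseudohyp_disk \<alpha> r \<longleftrightarrow> cmod (z - \<alpha>) < r * cmod (1 - cnj \<alpha> * z)"
  proof (cases "1 - cnj \<alpha> * z = 0")
    case False
    then show ?thesis using \<alpha> by (simp add: pseudohyp_disk_def norm_divide divide_simps)
  qed (use \<alpha> in \<open>simp add: pseudohyp_disk_def\<close>)
  have "cmod z < 1" if "cmod (z - \<alpha>) < r * cmod (1 - cnj \<alpha> * z)"
  proof -
    have "cmod (z - \<alpha>) < cmod (1 - cnj \<alpha> * z)"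
      using that r mult_right_mono[of r 1 "cmod (1 - cnj \<alpha> * z)"] by simp
    then have "(cmod (z - \<alpha>))\<^sup>2 < (cmod (1 - cnj \<alpha> * z))\<^sup>2"
      by (simp add: power_strict_mono)
    \<comment> \<open>This identity is what forces a point of the pseudohyperbolic disk into the
      unit disk.\<close>
    moreover have "(cmod (1 - cnj \<alpha> * z))\<^sup>2 - (cmod (z - \<alpha>))\<^sup>2
        = (1 - (cmod z)\<^sup>2) * (1 - (cmod \<alpha>)\<^sup>2)"
      unfolding cmod_power2 by (simp add: power2_eq_square algebra_simps)
    ultimately have "0 < (1 - (cmod z)\<^sup>2) * (1 - (cmod \<alpha>)\<^sup>2)" by simp
    moreover have "0 < 1 - (cmod \<alpha>)\<^sup>2" using \<alpha> by (simp add: power_less_one_iff)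
    ultimately have "0 < 1 - (cmod z)\<^sup>2" by (simp add: zero_less_mult_iff)
    then show ?thesis by (simp add: power_less_one_iff)
  qed
  moreover have "cmod (z - \<alpha>) < r * cmod (1 - cnj \<alpha> * z) \<longleftrightarrow>
      cmod (cayley z - cayley \<alpha>) < r * cmod (cayley z + cnj (cayley \<alpha>))" if "cmod z < 1"
  proof -
    have ne: "z \<noteq> 1" "\<alpha> \<noteq> 1" using that \<alpha> by auto
    define m where "m = cmod (1 - z) * cmod (1 - \<alpha>) / 2"
    have "0 < m" using ne by (simp add: m_def)
    then show ?thesis
      unfolding pseudohyp_cayley[OF ne] m_def[symmetric] by (simp add: mult.left_commute)
  qed
  ultimately show ?thesis using disk by blast
qed

text \<open>Among centres on the line, the one level with \<open>w\<close> is the best: a height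
  difference \<open>t\<close> adds the same \<open>t\<^sup>2\<close> to both squared moduli, which
  hurts as \<open>r < 1\<close>. At equal height only real parts remain.\<close>

lemma strip_iff_pseudohyp:
  fixes w :: complex
  assumes a: "0 < a" and r: "0 < r" "r < 1" and w: "0 < Re w"
  shows "(\<exists>v. Re v = a \<and> cmod (w - v) < r * cmod (w + cnj v)) \<longleftrightarrow>
    a * (1 - r) < Re w * (1 + r) \<and> Re w * (1 - r) < a * (1 + r)"
proof -
  have eq: "\<bar>Re w - a\<bar> < r * (Re w + a) \<longleftrightarrow>
      a * (1 - r) < Re w * (1 + r) \<and> Re w * (1 - r) < a * (1 + r)"
    by (auto simp: abs_less_iff algebra_simps)
  have "\<bar>Re w - a\<bar> < r * (Re w + a)" if v: "Re v = a" "cmod (w - v) < r * cmod (w + cnj v)" for v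
  proof -
    define t where "t = Im w - Im v"
    have "(cmod (w - v))\<^sup>2 < (r * cmod (w + cnj v))\<^sup>2"
      using v(2) by (simp add: power_strict_mono)
    then have "(Re w - a)\<^sup>2 + t\<^sup>2 < r\<^sup>2 * ((Re w + a)\<^sup>2 + t\<^sup>2)"
      using v(1) by (simp add: power_mult_distrib cmod_power2 t_def)
    moreover have "r\<^sup>2 * t\<^sup>2 \<le> 1 * t\<^sup>2"
      using r by (intro mult_right_mono) (simp_all add: power_le_one)
    ultimately have "\<bar>Re w - a\<bar>\<^sup>2 < (r * (Re w + a))\<^sup>2"
      unfolding power_mult_distrib distrib_left[of "r\<^sup>2"] power2_abs by linarith
    then show ?thesis
      by (rule power2_less_imp_less) (use a r w in simp)
  qed
  moreover have "cmod (w - Complex a (Im w)) < r * cmod (w + cnj (Complex a (Im w)))"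
    if "\<bar>Re w - a\<bar> < r * (Re w + a)"
  proof -
    have "w - Complex a (Im w) = of_real (Re w - a)"
      "w + cnj (Complex a (Im w)) = of_real (Re w + a)"
      by (simp_all add: complex_eq_iff)
    then show ?thesis using that a w by (simp only: norm_of_real)
  qed
  then have "\<exists>v. Re v = a \<and> cmod (w - v) < r * cmod (w + cnj v)"
    if "\<bar>Re w - a\<bar> < r * (Re w + a)"
    using that by (intro exI[of _ "Complex a (Im w)"]) simp
  ultimately show ?thesis unfolding eq[symmetric] by blast
qed

lemma cayley_horocycle:
  assumes "0 < k"
  shows "cayley ` (horocycle 1 k - {1}) = {v. Re v = 1 / k}"
    and "horocycle 1 k - {1} \<subseteq> ball 0 1"
proof -
  have H: "horocycle 1 k - {1} = {\<alpha>. cmod \<alpha> < 1 \<and> Re (cayley \<alpha>) = 1 / k}"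
  proof (intro set_eqI)
    fix \<alpha>
    define p q where "p = 1 - (cmod \<alpha>)\<^sup>2" and "q = (cmod (1 - \<alpha>))\<^sup>2"
    \<comment> \<open>If \<open>p\<close> or \<open>q\<close> is 0, both quotients are 0 and both
      equations fail, as \<open>k\<close> is positive.\<close>
    have "q / p = k \<longleftrightarrow> p / q = 1 / k" using assms by (auto simp: divide_simps mult.commute)
    moreover have "\<alpha> \<in> horocycle 1 k - {1} \<longleftrightarrow> \<alpha> \<noteq> 1 \<and> cmod \<alpha> < 1 \<and> q / p = k"
      unfolding horocycle_def p_def q_def norm_minus_commute[of 1 \<alpha>]
        Diff_iff Un_iff mem_Collect_eq singleton_iff mem_ball_0 by blast
    moreover have "Re (cayley \<alpha>) = p / q" by (simp add: Re_cayley p_def q_def)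
    ultimately show "\<alpha> \<in> horocycle 1 k - {1} \<longleftrightarrow> \<alpha> \<in> {\<alpha>. cmod \<alpha> < 1 \<and> Re (cayley \<alpha>) = 1 / k}"
      by (cases "\<alpha> = 1") simp_all
  qed
  show "horocycle 1 k - {1} \<subseteq> ball 0 1" unfolding H by auto
  show "cayley ` (horocycle 1 k - {1}) = {v. Re v = 1 / k}"
  proof
    show "{v. Re v = 1 / k} \<subseteq> cayley ` (horocycle 1 k - {1})"
    proof
      fix v assume v: "v \<in> {v. Re v = 1 / k}"
      then obtain z where "cmod z < 1" "cayley z = v" using assms cayley_surj[of v] by auto
      then show "v \<in> cayley ` (horocycle 1 k - {1})" using v unfolding H by auto
    qed
  qed (auto simp: H)
qed

section \<open>The swept region and its frontier\<close>

text \<open>These are the strip bounds for \<open>Re (cayley z)\<close> around \<open>1 / k\<close>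
  with denominators cleared, the shape that \<open>horoball_iff\<close> expects.\<close>

lemma Union_pseudohyp_disk_horocycle:
  assumes r: "0 < r" "r < 1" and k: "0 < k"
  shows "z \<in> (\<Union>\<alpha>\<in>horocycle 1 k. pseudohyp_disk \<alpha> r) \<longleftrightarrow>
    (1 - r) * (cmod (1 - z))\<^sup>2 < k * (1 + r) * (1 - (cmod z)\<^sup>2) \<and>
    k * (1 - r) * (1 - (cmod z)\<^sup>2) < (1 + r) * (cmod (1 - z))\<^sup>2"
proof -
  \<comment> \<open>The radius is 0, so every contributing centre lies in the open unit
    disk.\<close>
  have "pseudohyp_disk 1 r = {}" by (simp add: pseudohyp_disk_def)
  then have "z \<in> (\<Union>\<alpha>\<in>horocycle 1 k. pseudohyp_disk \<alpha> r) \<longleftrightarrow>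
      (\<exists>\<alpha>\<in>horocycle 1 k - {1}. z \<in> pseudohyp_disk \<alpha> r)" by auto
  also have "\<dots> \<longleftrightarrow> (\<exists>\<alpha>\<in>horocycle 1 k - {1}. cmod z < 1 \<and>
      cmod (cayley z - cayley \<alpha>) < r * cmod (cayley z + cnj (cayley \<alpha>)))"
    using cayley_horocycle(2)[OF k] pseudohyp_disk_iff[OF _ r]
    by (intro bex_cong) auto
  also have "\<dots> \<longleftrightarrow> cmod z < 1 \<and> (\<exists>v\<in>cayley ` (horocycle 1 k - {1}).
      cmod (cayley z - v) < r * cmod (cayley z + cnj v))" by blast
  also have "\<dots> \<longleftrightarrow> cmod z < 1 \<and> (\<exists>v. Re v = 1 / k \<and>
      cmod (cayley z - v) < r * cmod (cayley z + cnj v))"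
    unfolding cayley_horocycle(1)[OF k] by simp
  also have "\<dots> \<longleftrightarrow> cmod z < 1 \<and> (1 - r) * (cmod (1 - z))\<^sup>2 < k * (1 + r) * (1 - (cmod z)\<^sup>2) \<and>
    k * (1 - r) * (1 - (cmod z)\<^sup>2) < (1 + r) * (cmod (1 - z))\<^sup>2"
  proof (rule conj_cong[OF refl])
    assume z: "cmod z < 1"
    define p q where "p = 1 - (cmod z)\<^sup>2" and "q = (cmod (1 - z))\<^sup>2"
    have p: "0 < p" using z by (simp add: p_def power_less_one_iff)
    have q: "0 < q" using z by (auto simp: q_def)
    have Re: "Re (cayley z) = p / q" by (simp add: Re_cayley p_def q_def)
    have "0 < Re (cayley z)" using p q by (simp add: Re)
    then have "(\<exists>v. Re v = 1 / k \<and> cmod (cayley z - v) < r * cmod (cayley z + cnj v)) \<longleftrightarrow>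
        1 / k * (1 - r) < p / q * (1 + r) \<and> p / q * (1 - r) < 1 / k * (1 + r)"
      using strip_iff_pseudohyp[of "1 / k" r "cayley z"] r k by (simp add: Re)
    also have "\<dots> \<longleftrightarrow> (1 - r) * q < k * (1 + r) * p \<and> k * (1 - r) * p < (1 + r) * q"
      using q k by (simp add: field_simps)
    finally show "(\<exists>v. Re v = 1 / k \<and> cmod (cayley z - v) < r * cmod (cayley z + cnj v)) \<longleftrightarrow>
      (1 - r) * (cmod (1 - z))\<^sup>2 < k * (1 + r) * (1 - (cmod z)\<^sup>2) \<and>
      k * (1 - r) * (1 - (cmod z)\<^sup>2) < (1 + r) * (cmod (1 - z))\<^sup>2"
      unfolding p_def q_def .
  qed
  also have "\<dots> \<longleftrightarrow> (1 - r) * (cmod (1 - z))\<^sup>2 < k * (1 + r) * (1 - (cmod z)\<^sup>2) \<and>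
    k * (1 - r) * (1 - (cmod z)\<^sup>2) < (1 + r) * (cmod (1 - z))\<^sup>2"
  proof -
    \<comment> \<open>The lower strip bound alone makes \<open>1 - (cmod z)\<^sup>2\<close>
      positive.\<close>
    have "cmod z < 1" if *: "(1 - r) * (cmod (1 - z))\<^sup>2 < k * (1 + r) * (1 - (cmod z)\<^sup>2)"
    proof -
      have "0 \<le> (1 - r) * (cmod (1 - z))\<^sup>2" using r by simp
      with * have "0 < k * (1 + r) * (1 - (cmod z)\<^sup>2)" by linarith
      moreover have "0 < k * (1 + r)" using r k by simp
      ultimately have "0 < 1 - (cmod z)\<^sup>2" using zero_less_mult_pos by blast
      then show ?thesis by (simp add: power_less_one_iff)
    qed
    then show ?thesis by blast
  qed
  finally show ?thesis .
qed

theorem theorem6p1: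
  fixes r k c\<^sub>1 R\<^sub>1 c\<^sub>2 R\<^sub>2 :: real and \<D>\<^sub>1 \<D>\<^sub>2 :: "complex set"
  assumes "0 < r" and "r < 1" and "k > 0"
    and "c\<^sub>1 = (1 - r) / ((1 - r) + k * (1 + r))" and "R\<^sub>1 = 1 - c\<^sub>1"
    and "c\<^sub>2 = (1 + r) / ((1 + r) + k * (1 - r))" and "R\<^sub>2 = 1 - c\<^sub>2"
    and "\<D>\<^sub>1 = {z. cmod (z - of_real c\<^sub>1) < R\<^sub>1}"
    and "\<D>\<^sub>2 = {z. cmod (z - of_real c\<^sub>2) < R\<^sub>2}"
  shows "R\<^sub>1 = k * (1 + r) / ((1 - r) + k * (1 + r)) \<and>
    R\<^sub>2 = k * (1 - r) / ((1 + r) + k * (1 - r)) \<and>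
    frontier (\<Union>\<alpha>\<in>horocycle 1 k. pseudohyp_disk \<alpha> r) = frontier \<D>\<^sub>1 \<union> frontier \<D>\<^sub>2"
proof -
  note r = assms(1,2) and k = assms(3)
  define N\<^sub>1 N\<^sub>2 where "N\<^sub>1 = (1 - r) + k * (1 + r)" and "N\<^sub>2 = (1 + r) + k * (1 - r)"
  have N: "0 < N\<^sub>1" "0 < N\<^sub>2" using r k by (simp_all add: N\<^sub>1_def N\<^sub>2_def add_pos_pos)
  have c: "c\<^sub>1 = (1 - r) / N\<^sub>1" "c\<^sub>2 = (1 + r) / N\<^sub>2"
    using assms by (simp_all add: N\<^sub>1_def N\<^sub>2_def)
  have R: "R\<^sub>1 = k * (1 + r) / N\<^sub>1" "R\<^sub>2 = k * (1 - r) / N\<^sub>2"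
    using N unfolding assms(5,7) c by (simp_all add: field_simps)
      (simp_all add: N\<^sub>1_def N\<^sub>2_def algebra_simps)
  have Rpos: "0 < R\<^sub>1" "0 < R\<^sub>2" using R N r k by simp_all
  then have c1: "c\<^sub>1 < 1" "c\<^sub>2 < 1" using assms(5,7) by simp_all
  \<comment> \<open>Both circles pass through 1, so the order of the centres decides which is the
    inner one.\<close>
  have cc: "c\<^sub>1 < c\<^sub>2"
  proof -
    have "(1 - r) * (1 - r) < (1 + r) * (1 + r)" using r by (intro mult_strict_mono) auto
    then have "k * ((1 - r) * (1 - r)) < k * ((1 + r) * (1 + r))" using k by simp
    then have "(1 - r) * N\<^sub>2 < (1 + r) * N\<^sub>1" by (simp add: N\<^sub>1_def N\<^sub>2_def algebra_simps)
    then show ?thesis using N by (simp add: c divide_simps mult.commute)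
  qed
  have one_minus: "1 - c\<^sub>1 = k * (1 + r) / N\<^sub>1" "1 - c\<^sub>2 = k * (1 - r) / N\<^sub>2"
    using R assms(5,7) by simp_all
  \<comment> \<open>Dividing by \<open>N\<^sub>1\<close> and \<open>N\<^sub>2\<close> produces the
    coefficients of the two horoballs; the second bound is negated to express the complement of the
    closed inner disk.\<close>
  have scale: "(1 - r) * q < k * (1 + r) * p \<longleftrightarrow> c\<^sub>1 * q < (1 - c\<^sub>1) * p"
    "k * (1 - r) * p < (1 + r) * q \<longleftrightarrow> \<not> c\<^sub>2 * q \<le> (1 - c\<^sub>2) * p" for p q
    unfolding one_minus unfolding c using N by (simp_all add: divide_simps not_le)
  have U: "(\<Union>\<alpha>\<in>horocycle 1 k. pseudohyp_disk \<alpha> r) = ball (of_real c\<^sub>1) R\<^sub>1 - cball (of_real c\<^sub>2) R\<^sub>2"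
    unfolding assms(5,7) Diff_iff set_eq_iff Union_pseudohyp_disk_horocycle[OF r k]
      horoball_iff[OF c1(1)] horoball_iff[OF c1(2)] scale by blast
  have sub: "cball (of_real c\<^sub>2) R\<^sub>2 - {1} \<subseteq> ball (complex_of_real c\<^sub>1) R\<^sub>1"
  proof
    fix z :: complex assume "z \<in> cball (of_real c\<^sub>2) R\<^sub>2 - {1}"
    then have z: "z \<noteq> 1" "c\<^sub>2 * (cmod (1 - z))\<^sup>2 \<le> (1 - c\<^sub>2) * (1 - (cmod z)\<^sup>2)"
      using horoball_iff(2)[OF c1(2)] assms(7) by auto
    define p q where "p = 1 - (cmod z)\<^sup>2" and "q = (cmod (1 - z))\<^sup>2"
    have q: "0 < q" using z(1) by (simp add: q_def)
    have "0 < c\<^sub>2" using c N r by simp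
    then have "0 < c\<^sub>2 * q" using q by simp
    moreover have le: "c\<^sub>2 * q \<le> (1 - c\<^sub>2) * p" using z(2) by (simp add: p_def q_def)
    ultimately have "0 < (1 - c\<^sub>2) * p" by linarith
    then have p: "0 < p" using c1(2) by (simp add: zero_less_mult_iff)
    \<comment> \<open>Strictness comes from \<open>q > 0\<close>, that is
      \<open>z \<noteq> 1\<close>: the circles meet only at 1.\<close>
    have "c\<^sub>1 * q < c\<^sub>2 * q" using cc q by simp
    also note le
    also have "(1 - c\<^sub>2) * p \<le> (1 - c\<^sub>1) * p" using cc p by simp
    finally show "z \<in> ball (of_real c\<^sub>1) R\<^sub>1"
      using horoball_iff(1)[OF c1(1)] assms(5) by (simp add: p_def q_def)
  qed
  have "dist (complex_of_real c\<^sub>1) 1 = R\<^sub>1"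
    using c1(1) assms(5) dist_of_real[of c\<^sub>1 1, where 'a = complex] by (simp add: dist_real_def)
  then have "frontier (\<Union>\<alpha>\<in>horocycle 1 k. pseudohyp_disk \<alpha> r)
      = sphere (of_real c\<^sub>1) R\<^sub>1 \<union> sphere (of_real c\<^sub>2) R\<^sub>2"
    unfolding U using Rpos sub by (intro frontier_ball_diff_tangent_cball[where p = 1]) auto
  \<comment> \<open>As the radii are positive, the frontiers of these balls are the two
    spheres.\<close>
  moreover have "\<D>\<^sub>1 = ball (of_real c\<^sub>1) R\<^sub>1" "\<D>\<^sub>2 = ball (of_real c\<^sub>2) R\<^sub>2"
    using assms(8,9) by (auto simp: dist_norm norm_minus_commute)
  ultimately show ?thesis
    using R Rpos unfolding N\<^sub>1_def N\<^sub>2_def by simp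
qed

end
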